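(* Let $\lambda>-1$ and $t\in\mathbb{R}$, and let $S_n(x)=S_n(x;t,\lambda)$, $n\ge0$, be the monic orthogonal polynomials with respect to the generalised sextic Freud weight $\omega(x;t,\lambda)=|x|^{2\lambda+1}\exp(-x^6+tx^2)$ on $\mathbb{R}$, with recurrence coefficients $\beta_n=\beta_n(t;\lambda)$. Then for every $n\ge0$, as an identity of rational functions of $x$, $$x\frac{\mathrm{d}^2S_n}{\mathrm{d}x^2}(x)+Q_n(x)\frac{\mathrm{d}S_n}{\mathrm{d}x}(x)+T_n(x)S_n(x)=0,$$ where $$Q_n(x)=2tx^2-6x^6+2\lambda+1-\frac{2x^2\left(2x^2+\beta_n+\beta_{n+1}\right)}{C_n(x)},$$ \begin{align*} T_n(x)=\;&36x\beta_nC_{n-1}(x)C_n(x)+12x^3\beta_n+\frac{2\lambda+1}{x}\left\{6x^2\beta_nD_n(x)+(\lambda+\tfrac12)[1-(-1)^n]\right\}+12x\beta_nD_n(x)\\ &-\left\{6x^2\beta_nD_n(x)+(\lambda+\tfrac12)[1-(-1)^n]\right\}\left\{6x\beta_nD_n(x)+\frac{2\lambda+1}{2x}[1-(-1)^n]-2tx+6x^5\right\}\\ &-\frac{\left\{C_n(x)+4x^4+2x^2(\beta_n+\beta_{n+1})\right\}\left\{6x^2\beta_nD_n(x)+(\lambda+\tfrac12)[1-(-1)^n]\right\}}{x\,C_n(x)}, \end{align*} with $$C_n(x)=x^4-\tfrac13t+x^2(\beta_n+\beta_{n+1})+\beta_{n+2}\beta_{n+1}+(\beta_{n+1}+\beta_n)^2+\beta_{n-1}\beta_n,\qquad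 D_n(x)=x^2+\beta_{n-1}+\beta_n+\beta_{n+1}.$$
   Context: $S_n(x;t,\lambda)$ is the monic polynomial of degree $n$ with $\int_{-\infty}^\infty S_m(x)S_n(x)\,|x|^{2\lambda+1}\exp(-x^6+tx^2)\,\mathrm{d}x=0$ for $m\ne n$. Since the weight is even, the polynomials satisfy the three-term recurrence $S_{n+1}(x)=xS_n(x)-\beta_n(t;\lambda)S_{n-1}(x)$, $n\ge0$, with $S_{-1}=0$, $S_0=1$, which defines $\beta_n>0$ for $n\ge1$; conventions: $\beta_k=0$ for $k\le0$. *)

theory Defs
  imports "HOL-Analysis.Analysis" "HOL-Computational_Algebra.Computational_Algebra"
begin

text \<open>Since \<open>0 powr a = 0\<close>, the value at \<open>x = 0\<close> is \<open>0\<close>, whatever \<open>\<lambda>\<close> is;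
  this concerns a null set only.\<close>

definition sextic_freud_weight :: "real \<Rightarrow> real \<Rightarrow> real \<Rightarrow> real" where
  "sextic_freud_weight lam t x = \<bar>x\<bar> powr (2 * lam + 1) * exp (- (x ^ 6) + t * x ^ 2)"

text \<open>The Bochner integral of a non-integrable function is \<open>0\<close>, so the orthogonality clause
  is meaningful only for weights with finite moments. For the sextic Freud weight this is
  the case exactly when \<open>\<lambda> > -1\<close>.\<close>

definition monic_orthogonal_polys :: "(real \<Rightarrow> real) \<Rightarrow> (nat \<Rightarrow> real poly) \<Rightarrow> bool" where
  "monic_orthogonal_polys w S \<longleftrightarrow>
     (\<forall>n. degree (S n) = n \<and> lead_coeff (S n) = 1) \<and>
     (\<forall>m n. m \<noteq> n \<longrightarrow> (LINT x|lborel. poly (S m) x * poly (S n) x * w x) = 0)"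

text \<open>The coefficient \<open>\<beta>\<^sub>k\<close> of \<open>S\<^sub>k\<^sub>+\<^sub>1 = x S\<^sub>k - \<beta>\<^sub>k S\<^sub>k\<^sub>-\<^sub>1\<close>. The index is an integer because
  \<open>\<beta>\<^sub>-\<^sub>2\<close>, \<open>\<beta>\<^sub>-\<^sub>1\<close> and \<open>\<beta>\<^sub>0\<close> occur in the formulas below for small \<open>n\<close>.\<close>

definition recurrence_coeff :: "(nat \<Rightarrow> real poly) \<Rightarrow> int \<Rightarrow> real" where
  "recurrence_coeff S k =
     (if k \<le> 0 then 0
      else (THE b. S (nat k + 1) = [:0, 1:] * S (nat k) - smult b (S (nat k - 1))))"

type_synonym ratfun = "real poly fract"

definition ratX :: ratfun where
  "ratX = to_fract [:0, 1:]"

definition ratconst :: "real \<Rightarrow> ratfun" where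
  "ratconst c = to_fract [:c:]"

text \<open>In the following definitions \<open>b\<close> is the sequence of recurrence coefficients.\<close>

definition freud_C :: "real \<Rightarrow> (int \<Rightarrow> real) \<Rightarrow> int \<Rightarrow> ratfun" where
  "freud_C t b n =
     ratX ^ 4 - ratconst (t / 3) + ratX ^ 2 * ratconst (b n + b (n + 1))
     + ratconst (b (n + 2) * b (n + 1) + (b (n + 1) + b n) ^ 2 + b (n - 1) * b n)"

definition freud_D :: "(int \<Rightarrow> real) \<Rightarrow> int \<Rightarrow> ratfun" where
  "freud_D b n = ratX ^ 2 + ratconst (b (n - 1) + b n + b (n + 1))"

definition freud_Q :: "real \<Rightarrow> real \<Rightarrow> (int \<Rightarrow> real) \<Rightarrow> int \<Rightarrow> ratfun" where
  "freud_Q lam t b n =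
     ratconst (2 * t) * ratX ^ 2 - 6 * ratX ^ 6 + ratconst (2 * lam + 1)
     - 2 * ratX ^ 2 * (2 * ratX ^ 2 + ratconst (b n + b (n + 1))) / freud_C t b n"

definition freud_T :: "real \<Rightarrow> real \<Rightarrow> (int \<Rightarrow> real) \<Rightarrow> nat \<Rightarrow> ratfun" where
  "freud_T lam t b n =
     (let x = ratX; \<beta> = ratconst (b (int n)); s = ratconst (b (int n) + b (int n + 1));
          C = freud_C t b (int n); C' = freud_C t b (int n - 1); D = freud_D b (int n) in
      36 * x * \<beta> * C' * C + 12 * x ^ 3 * \<beta>
      + ratconst (2 * lam + 1) / x
        * (6 * x ^ 2 * \<beta> * D + ratconst (lam + 1 / 2) * (1 - (- 1) ^ n))
      + 12 * x * \<beta> * D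
      - (6 * x ^ 2 * \<beta> * D + ratconst (lam + 1 / 2) * (1 - (- 1) ^ n))
        * (6 * x * \<beta> * D + ratconst (2 * lam + 1) / (2 * x) * (1 - (- 1) ^ n)
           - ratconst (2 * t) * x + 6 * x ^ 5)
      - (C + 4 * x ^ 4 + 2 * x ^ 2 * s)
        * (6 * x ^ 2 * \<beta> * D + ratconst (lam + 1 / 2) * (1 - (- 1) ^ n)) / (x * C))"

end

theory Submission
  imports Defs "HOL-Real_Asymp.Real_Asymp"
begin

text \<open>The equation follows from a pair of ladder relations. With \<open>E\<^sub>n = 6 x\<^sup>2 \<beta>\<^sub>n D\<^sub>n +
  (\<lambda> + 1/2) (1 - (-1)\<^sup>n)\<close> and \<open>V = - x w'(x) / w(x) = 6 x\<^sup>6 - 2 t x\<^sup>2 - (2 \<lambda> + 1)\<close> they read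

    \<open>x S\<^sub>n' = 6 x \<beta>\<^sub>n C\<^sub>n S\<^sub>n\<^sub>-\<^sub>1 - E\<^sub>n S\<^sub>n\<close> (lemma \<open>lowering\<close>),

    \<open>x S\<^sub>n\<^sub>-\<^sub>1' = (E\<^sub>n + V) S\<^sub>n\<^sub>-\<^sub>1 - 6 x C\<^sub>n\<^sub>-\<^sub>1 S\<^sub>n\<close> (lemma \<open>raising\<close>, after multiplication by \<open>\<beta>\<^sub>n\<close>).

  Differentiating the first, inserting the second and eliminating \<open>S\<^sub>n\<^sub>-\<^sub>1\<close> gives a second order equation
  with the stated coefficients (lemma \<open>second_order_equation\<close>).

  The ladder relations are proved by induction on \<open>n\<close>, without kernels of Christoffel-Darboux type.
  By the three-term recurrence, lowering at \<open>n - 1\<close> gives raising from \<open>n - 1\<close> to \<open>n\<close>, and lowering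
  propagates from \<open>n - 1\<close> and \<open>n\<close> to \<open>n + 1\<close>, because

    \<open>E\<^sub>n + E\<^sub>n\<^sub>+\<^sub>1 + V = 6 x\<^sup>2 C\<^sub>n\<close> and \<open>1 + E\<^sub>n\<^sub>+\<^sub>1 - E\<^sub>n = 6 (\<beta>\<^sub>n\<^sub>+\<^sub>1 C\<^sub>n\<^sub>+\<^sub>1 - \<beta>\<^sub>n C\<^sub>n\<^sub>-\<^sub>1)\<close>.

  The first identity is formal. The second is formal up to its constant coefficient in \<open>x\<close>, which is
  the difference of two consecutive instances of the discrete string equation for \<open>\<beta>\<^sub>n\<close> (lemma
  \<open>string_equation\<close>). So the ladder relations need no more from the weight than this scalar
  equation and the recurrence. The string equation comes from evaluating the integral of
  \<open>(S\<^sub>n S\<^sub>n\<^sub>-\<^sub>1)' w\<close> by orthogonality and by parts.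

  About the integral only four facts are needed: finiteness of moments, positivity, evenness, and
  integration by parts with the factor \<open>x\<close> that cancels the pole of \<open>w' / w\<close> at the origin.\<close>

section \<open>Moments of the sextic Freud weight\<close>

lemma poly_le_exp_abs:
  fixes p :: "real poly"
  obtains M c where "M \<ge> 0" "c \<ge> 0" "\<And>x. \<bar>poly p x\<bar> \<le> M * exp (c * \<bar>x\<bar>)"
proof -
  have "\<exists>M\<ge>0. \<exists>c\<ge>0. \<forall>x. \<bar>poly p x\<bar> \<le> M * exp (c * \<bar>x\<bar>)"
  proof (induction p)
    case 0
    show ?case by (rule exI[of _ 0]) auto
  next
    case (pCons a p)
    then obtain M c where M: "M \<ge> 0" "c \<ge> 0" "\<And>x. \<bar>poly p x\<bar> \<le> M * exp (c * \<bar>x\<bar>)"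
      by blast
    have "\<bar>poly (pCons a p) x\<bar> \<le> (\<bar>a\<bar> + M) * exp ((c + 1) * \<bar>x\<bar>)" for x
    proof -
      have "\<bar>poly (pCons a p) x\<bar> \<le> \<bar>a\<bar> + \<bar>x\<bar> * \<bar>poly p x\<bar>"
        by (simp add: abs_triangle_ineq flip: abs_mult)
      also have "\<bar>x\<bar> * \<bar>poly p x\<bar> \<le> exp \<bar>x\<bar> * (M * exp (c * \<bar>x\<bar>))"
      proof (intro mult_mono M)
        show "\<bar>x\<bar> \<le> exp \<bar>x\<bar>" using exp_ge_add_one_self[of "\<bar>x\<bar>"] by linarith
      qed (use M in auto)
      also have "\<dots> = M * exp ((c + 1) * \<bar>x\<bar>)"
        by (simp add: exp_add algebra_simps)
      also have "\<bar>a\<bar> \<le> \<bar>a\<bar> * exp ((c + 1) * \<bar>x\<bar>)"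
        using M(2) by (simp add: mult_le_cancel_left1)
      finally show ?thesis by (simp add: algebra_simps)
    qed
    with M show ?case by (intro exI[of _ "\<bar>a\<bar> + M"] exI[of _ "c + 1"] conjI) auto
  qed
  then show ?thesis using that by blast
qed

lemma linear_le_cube:
  fixes K y :: real
  assumes "K \<ge> 1" "y \<ge> 0"
  shows "K * y \<le> K ^ 2 + y ^ 3"
proof (cases "y \<le> K")
  case True
  then have "K * y \<le> K ^ 2" using assms by (simp add: power2_eq_square)
  with assms show ?thesis by (simp add: add_increasing2)
next
  case False
  then have "K * 1 \<le> y * y" using assms by (intro mult_mono) auto
  then have "K * y \<le> y ^ 3"
    using mult_right_mono[of "K * 1" "y * y" y] assms by (simp add: power3_eq_cube)
  then show ?thesis by (simp add: add_increasing)
qed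

text \<open>Since \<open>x\<^sup>6\<close> outgrows \<open>t x\<^sup>2\<close> and every multiple of \<open>\<bar>x\<bar>\<close>, a polynomial times the weight is
  dominated by the Gamma integrand. Both integrability and the decay at infinity rest on this
  one bound.\<close>

lemma poly_times_weight_bound:
  fixes p :: "real poly"
  obtains M where "M \<ge> 0"
    "\<And>x. \<bar>poly p x\<bar> * sextic_freud_weight lam t x
          \<le> M * (\<bar>x\<bar> powr (2 * lam + 1) * exp (- \<bar>x\<bar>))"
proof -
  obtain M c where M: "M \<ge> 0" "c \<ge> 0" "\<And>x. \<bar>poly p x\<bar> \<le> M * exp (c * \<bar>x\<bar>)"
    using poly_le_exp_abs[of p] by metis
  define K where "K = c + 1 + \<bar>t\<bar>"
  have expo: "c * \<bar>x\<bar> + (- (x ^ 6) + t * x\<^sup>2) \<le> (c + 1 + K\<^sup>2) - \<bar>x\<bar>" for x :: real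
  proof -
    have "\<bar>x\<bar> \<le> 1 + x\<^sup>2"
      using zero_le_power2[of "\<bar>x\<bar> - 1"] abs_ge_zero[of x]
      by (simp add: power2_diff)
    then have "(c + 1) * \<bar>x\<bar> \<le> (c + 1) * (1 + x\<^sup>2)"
      using M(2) by (intro mult_left_mono) auto
    moreover have "t * x\<^sup>2 \<le> \<bar>t\<bar> * x\<^sup>2" by (intro mult_right_mono) auto
    (* K * x^2 absorbs both quadratic terms above; linear_le_cube at x^2 trades it for x^6. *)
    moreover have "K * x\<^sup>2 \<le> K\<^sup>2 + (x\<^sup>2) ^ 3"
      by (rule linear_le_cube) (use M(2) in \<open>auto simp: K_def\<close>)
    moreover have "(x\<^sup>2) ^ 3 = x ^ 6" by (simp flip: power_mult)
    ultimately show ?thesis by (simp add: K_def algebra_simps)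
  qed
  have "\<bar>poly p x\<bar> * sextic_freud_weight lam t x
          \<le> M * exp (c + 1 + K\<^sup>2) * (\<bar>x\<bar> powr (2 * lam + 1) * exp (- \<bar>x\<bar>))" for x
  proof -
    have "\<bar>poly p x\<bar> * exp (- (x ^ 6) + t * x\<^sup>2)
            \<le> M * exp (c * \<bar>x\<bar>) * exp (- (x ^ 6) + t * x\<^sup>2)"
      by (intro mult_right_mono M) auto
    also have "\<dots> = M * exp (c * \<bar>x\<bar> + (- (x ^ 6) + t * x\<^sup>2))"
      by (simp only: exp_add mult.assoc)
    also have "\<dots> \<le> M * exp (c + 1 + K\<^sup>2 - \<bar>x\<bar>)"
      using expo[of x] M(1) by (intro mult_left_mono) auto
    finally have "\<bar>x\<bar> powr (2 * lam + 1) * (\<bar>poly p x\<bar> * exp (- (x ^ 6) + t * x\<^sup>2))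
        \<le> \<bar>x\<bar> powr (2 * lam + 1) * (M * exp (c + 1 + K\<^sup>2 - \<bar>x\<bar>))"
      by (intro mult_left_mono) auto
    then show ?thesis
      by (simp add: sextic_freud_weight_def exp_diff exp_minus field_simps)
  qed
  then show ?thesis using that[of "M * exp (c + 1 + K\<^sup>2)"] M(1) by simp
qed

text \<open>This is the Gamma integral \<open>\<Gamma>(a + 1)\<close> on the half-line, added to its mirror image.\<close>

lemma integrable_abs_powr_exp:
  fixes a :: real
  assumes "a > -1"
  shows "integrable lborel (\<lambda>x. \<bar>x\<bar> powr a * exp (- \<bar>x\<bar>))"
proof -
  let ?g = "\<lambda>x::real. indicator {0..} x * x powr a / exp x"
  have g: "integrable lborel ?g"
  proof (rule integrableI_nonneg)
    show "(\<integral>\<^sup>+x. ennreal (?g x) \<partial>lborel) < \<infinity>"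
      using Gamma_conv_nn_integral_real[of "a + 1"] assms
      by (simp, metis ennreal_less_top)
  qed auto
  have "integrable lborel (\<lambda>x. ?g x + ?g (0 + (-1) * x))"
    by (intro Bochner_Integration.integrable_add g lborel_integrable_real_affine) simp
  then show ?thesis
    by (rule Bochner_Integration.integrable_cong[THEN iffD1, rotated -1])
       (auto simp: indicator_def exp_minus field_simps)
qed

lemma sextic_freud_weight_nonneg: "sextic_freud_weight lam t x \<ge> 0"
  by (simp add: sextic_freud_weight_def)

lemma sextic_freud_weight_measurable [measurable]:
  "sextic_freud_weight lam t \<in> borel_measurable borel"
  unfolding sextic_freud_weight_def by measurable

lemma poly_measurable [measurable]: "poly (p :: real poly) \<in> borel_measurable borel"
  by (intro borel_measurable_continuous_onI continuous_intros)

lemma integrable_poly_weight: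
  assumes "lam > -1"
  shows "integrable lborel (\<lambda>x. poly p x * sextic_freud_weight lam t x)"
proof -
  obtain M where M: "M \<ge> 0" "\<And>x. \<bar>poly p x\<bar> * sextic_freud_weight lam t x
          \<le> M * (\<bar>x\<bar> powr (2 * lam + 1) * exp (- \<bar>x\<bar>))"
    using poly_times_weight_bound[of p lam t] by metis
  have "integrable lborel (\<lambda>x. M * (\<bar>x\<bar> powr (2 * lam + 1) * exp (- \<bar>x\<bar>)))"
    using assms by (intro integrable_mult_right integrable_abs_powr_exp) simp
  then show ?thesis
  proof (rule Bochner_Integration.integrable_bound)
    show "AE x in lborel. norm (poly p x * sextic_freud_weight lam t x)
        \<le> norm (M * (\<bar>x\<bar> powr (2 * lam + 1) * exp (- \<bar>x\<bar>)))"
      using M by (auto simp: abs_mult sextic_freud_weight_nonneg)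
  qed measurable
qed

definition freud_moment :: "real \<Rightarrow> real \<Rightarrow> real poly \<Rightarrow> real" where
  "freud_moment lam t p = (LINT x|lborel. poly p x * sextic_freud_weight lam t x)"

lemma freud_moment_square_pos:
  assumes "lam > -1" "p \<noteq> 0"
  shows "freud_moment lam t (p * p) > 0"
proof -
  let ?f = "\<lambda>x. poly (p * p) x * sextic_freud_weight lam t x"
  have nonneg: "?f x \<ge> 0" for x by (simp add: sextic_freud_weight_nonneg)
  have "(LINT x|lborel. ?f x) \<noteq> 0"
  proof
    assume "(LINT x|lborel. ?f x) = 0"
    then have ae: "AE x in lborel. ?f x = 0"
      using integral_nonneg_eq_0_iff_AE[OF integrable_poly_weight[OF assms(1), of "p * p"]] nonneg
      by auto
    have "AE x in lborel. x \<notin> {x. poly p x = 0} \<union> {0 :: real}"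
      by (rule AE_not_in, rule finite_imp_null_set_lborel) (use assms poly_roots_finite in auto)
    with ae have "AE x in (lborel :: real measure). False"
      by eventually_elim (auto simp: sextic_freud_weight_def)
    then have "ae_filter (lborel :: real measure) = bot" by (simp only: trivial_limit_def)
    then show False by (simp add: ae_filter_eq_bot_iff)
  qed
  moreover have "(LINT x|lborel. ?f x) \<ge> 0" using nonneg by (intro Bochner_Integration.integral_nonneg) auto
  ultimately show ?thesis by (simp add: freud_moment_def)
qed

lemma freud_moment_reflect:
  "freud_moment lam t (p \<circ>\<^sub>p [:0, -1:]) = freud_moment lam t p"
  using lborel_integral_real_affine[of "-1" "\<lambda>x. poly p x * sextic_freud_weight lam t x" 0]
  by (simp add: freud_moment_def poly_pcompose sextic_freud_weight_def)

text \<open>For \<open>a < 0\<close> the factor \<open>\<bar>x\<bar> powr a\<close> blows up at the origin; the factor \<open>x\<close> restores continuity there,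
  since the product is a difference of two powers with the positive exponent \<open>a + 1\<close>.\<close>

lemma continuous_times_abs_powr:
  fixes a :: real
  assumes "a > -1"
  shows "continuous_on A (\<lambda>x. x * \<bar>x\<bar> powr a)"
proof -
  have "x * \<bar>x\<bar> powr a = (max x 0) powr (a + 1) - (max (- x) 0) powr (a + 1)" for x
    by (cases x "0 :: real" rule: linorder_cases) (auto simp: powr_add max_def)
  moreover have "continuous_on A (\<lambda>x. (max x 0) powr (a + 1) - (max (- x) 0) powr (a + 1))"
    using assms by (intro continuous_intros continuous_on_powr') auto
  ultimately show ?thesis by simp
qed

text \<open>The Pearson equation \<open>x w'(x) = (2 \<lambda> + 1 + 2 t x\<^sup>2 - 6 x\<^sup>6) w(x)\<close> has polynomial coefficients, so
  the derivative is again a polynomial times the weight. Without the factor \<open>x\<close> the pole of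
  \<open>w'(x) / w(x)\<close> at the origin would remain.\<close>

lemma DERIV_weight:
  assumes "x \<noteq> 0"
  shows "((\<lambda>x. x * poly p x * sextic_freud_weight lam t x) has_real_derivative
    poly ([:0, 1:] * pderiv p + [:2 * lam + 2, 0, 2 * t, 0, 0, 0, -6:] * p) x
      * sextic_freud_weight lam t x) (at x)"
proof -
  have d: "((\<lambda>x. \<bar>x\<bar> powr (2 * lam + 1)) has_real_derivative
      (2 * lam + 1) * \<bar>x\<bar> powr (2 * lam + 1) / x) (at x)"
  proof -
    have abs: "(abs has_real_derivative sgn x) (at x)"
    proof (cases "x > 0")
      case True
      then show ?thesis
        using has_field_derivative_transform_within_open[OF DERIV_ident, of "{0<..}" x abs] by simp
    next
      case False
      then show ?thesis
        using has_field_derivative_transform_within_open[OF DERIV_minus[OF DERIV_ident], of "{..<0}" x abs]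
          assms by simp
    qed
    have "((\<lambda>x. \<bar>x\<bar> powr (2 * lam + 1)) has_real_derivative
      (2 * lam + 1) * \<bar>x\<bar> powr (2 * lam + 1 - 1) * sgn x) (at x)"
      using assms by (intro DERIV_chain2[OF has_real_derivative_powr abs]) simp
    moreover have "\<bar>x\<bar> powr (2 * lam + 1 - 1) * sgn x = \<bar>x\<bar> powr (2 * lam + 1) / x"
      using assms by (subst powr_diff) (auto simp: sgn_if)
    ultimately show ?thesis by (simp add: mult.assoc)
  qed
  show ?thesis
    unfolding sextic_freud_weight_def
    by (rule derivative_eq_intros d refl poly_DERIV)+
       (use assms in \<open>simp add: field_simps eval_nat_numeral\<close>)
qed

text \<open>The integrand is the derivative of \<open>x p(x) w(x)\<close>, which vanishes at infinity. That function is
  continuous at the origin, so the fundamental theorem of calculus tolerates the one point where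
  it may fail to be differentiable.\<close>

lemma freud_moment_by_parts:
  assumes "lam > -1"
  shows "freud_moment lam t
    ([:0, 1:] * pderiv p + [:2 * lam + 2, 0, 2 * t, 0, 0, 0, -6:] * p) = 0"
proof -
  define F where "F x = x * poly p x * sextic_freud_weight lam t x" for x
  define f where "f x = poly ([:0, 1:] * pderiv p + [:2 * lam + 2, 0, 2 * t, 0, 0, 0, -6:] * p) x
      * sextic_freud_weight lam t x" for x
  have int: "integrable lborel f"
    unfolding f_def by (rule integrable_poly_weight[OF assms])
  have meas[measurable]: "f \<in> borel_measurable borel"
    using int by auto
  have "F x = x * \<bar>x\<bar> powr (2 * lam + 1) * (poly p x * exp (- (x ^ 6) + t * x ^ 2))" for x
    by (simp add: F_def sextic_freud_weight_def)
  then have cont: "continuous_on A F" for A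
    using assms by (auto intro!: continuous_intros continuous_times_abs_powr)
  have FTC: "(LINT x|lborel. indicator {- real n..real n} x *\<^sub>R f x) = F (real n) - F (- real n)" for n
  proof -
    have "(f has_integral F (real n) - F (- real n)) {- real n..real n}"
    proof (rule fundamental_theorem_of_calculus_strong[of "{0}"])
      fix x assume "x \<in> {- real n..real n} - {0}"
      then show "(F has_vector_derivative f x) (at x)"
        using DERIV_weight[of x p lam t]
        by (simp add: F_def[abs_def] f_def flip: has_real_derivative_iff_has_vector_derivative)
    qed (auto intro: cont)
    moreover have "set_integrable lborel {- real n..real n} f"
      unfolding set_integrable_def by (rule integrable_mult_indicator[OF _ int]) auto
    ultimately show ?thesis
      using set_borel_integral_eq_integral(2)[of "{- real n..real n}" f]
      by (simp add: set_lebesgue_integral_def integral_unique)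
  qed
  have lim: "(\<lambda>n. LINT x|lborel. indicator {- real n..real n} x *\<^sub>R f x) \<longlonglongrightarrow> (LINT x|lborel. f x)"
  proof (rule integral_dominated_convergence[where w = "\<lambda>x. \<bar>f x\<bar>"])
    show "AE x in lborel. (\<lambda>n. indicator {- real n..real n} x *\<^sub>R f x) \<longlonglongrightarrow> f x"
    proof (rule AE_I2, rule tendsto_eventually)
      fix x
      show "\<forall>\<^sub>F n in sequentially. indicator {- real n..real n} x *\<^sub>R f x = f x"
        using eventually_ge_at_top[of "nat \<lceil>\<bar>x\<bar>\<rceil>"]
        by eventually_elim (auto simp: indicator_def nat_le_iff ceiling_le_iff)
    qed
    show "AE x in lborel. norm (indicator {- real n..real n} x *\<^sub>R f x) \<le> \<bar>f x\<bar>" for n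
      by (auto simp: indicator_def)
  qed (use int in auto)
  obtain M where M: "M \<ge> 0" "\<And>x. \<bar>poly (pCons 0 p) x\<bar> * sextic_freud_weight lam t x
          \<le> M * (\<bar>x\<bar> powr (2 * lam + 1) * exp (- \<bar>x\<bar>))"
    using poly_times_weight_bound[of "pCons 0 p" lam t] by metis
  have bound: "\<bar>F x\<bar> \<le> M * (\<bar>x\<bar> powr (2 * lam + 1) * exp (- \<bar>x\<bar>))" for x
    using M(2)[of x] by (simp add: F_def abs_mult sextic_freud_weight_nonneg)
  have decay: "(\<lambda>n. M * (real n powr (2 * lam + 1) * exp (- real n))) \<longlonglongrightarrow> 0"
    by real_asymp
  have "(\<lambda>n. F (real n)) \<longlonglongrightarrow> 0"
    by (rule Lim_null_comparison[OF _ decay], rule always_eventually) (use bound[of "real _"] in simp)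
  moreover have "(\<lambda>n. F (- real n)) \<longlonglongrightarrow> 0"
    by (rule Lim_null_comparison[OF _ decay], rule always_eventually) (use bound[of "- real _"] in simp)
  ultimately have "(\<lambda>n. F (real n) - F (- real n)) \<longlonglongrightarrow> 0 - 0"
    by (rule tendsto_diff)
  with lim have "(LINT x|lborel. f x) = 0"
    unfolding FTC by (simp add: LIMSEQ_unique)
  then show ?thesis by (simp add: freud_moment_def f_def)
qed

section \<open>Orthogonal polynomials of an even functional\<close>

lemma reflect_reflect: "p \<circ>\<^sub>p [:0, -1:] \<circ>\<^sub>p [:0, -1:] = (p :: real poly)"
  by (rule poly_eqI) (simp add: coeff_pcompose_linear minus_one_power_iff)

text \<open>Everything algebraic needs the integral only as a positive definite linear functional that is
  invariant under \<open>x \<mapsto> - x\<close>.\<close>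

locale even_orthogonal_polys =
  fixes L :: "real poly \<Rightarrow> real" and S :: "nat \<Rightarrow> real poly"
  assumes L_add: "L (p + q) = L p + L q"
    and L_smult: "L (smult c p) = c * L p"
    and L_square_pos: "p \<noteq> 0 \<Longrightarrow> L (p * p) > 0"
    and L_reflect: "L (p \<circ>\<^sub>p [:0, -1:]) = L p"
    and degree_S: "degree (S n) = n"
    and lead_coeff_S: "lead_coeff (S n) = 1"
    and orthogonal: "m \<noteq> n \<Longrightarrow> L (S m * S n) = 0"
begin

lemma L_0 [simp]: "L 0 = 0"
  using L_smult[of 0 0] by simp

lemma L_minus: "L (- p) = - L p"
  using L_smult[of "-1" p] by simp

lemma L_diff: "L (p - q) = L p - L q"
  using L_add[of p "- q"] by (simp add: L_minus)

lemma L_const_mult: "L ([:c:] * p) = c * L p"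
  using L_smult[of c p] by simp

lemma coeff_S_self [simp]: "coeff (S n) n = 1"
  using lead_coeff_S[of n] by (simp add: degree_S)

lemma coeff_S_above: "i > n \<Longrightarrow> coeff (S n) i = 0"
  by (simp add: coeff_eq_0 degree_S)

lemma S_nonzero [simp]: "S n \<noteq> 0"
  using coeff_S_self[of n] by (metis coeff_0 zero_neq_one)

lemma S_0: "S 0 = 1"
proof (rule poly_eqI)
  show "coeff (S 0) i = coeff 1 i" for i
    using coeff_S_self[of 0] by (cases i) (simp_all add: coeff_S_above)
qed

definition h :: "nat \<Rightarrow> real" where
  "h n = L (S n * S n)"

lemma h_pos: "h n > 0"
  unfolding h_def by (rule L_square_pos) simp

text \<open>Subtracting multiples of \<open>S k\<close> removes the coefficients of \<open>q\<close> from the top down, and each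
  removed term except the \<open>n\<close>-th is orthogonal to \<open>S n\<close>.\<close>

lemma L_times_S:
  assumes "\<And>i. i > n \<Longrightarrow> coeff q i = 0"
  shows "L (q * S n) = coeff q n * h n"
proof -
  have lower: "L (q * S n) = 0" if "\<And>i. i \<ge> k \<Longrightarrow> coeff q i = 0" "k \<le> n" for q k
    using that
  proof (induction k arbitrary: q)
    case 0
    then have "q = 0" by (intro poly_eqI) simp
    then show ?case by simp
  next
    case (Suc k)
    have "L ((q - smult (coeff q k) (S k)) * S n) = 0"
    proof (rule Suc.IH)
      fix i assume "i \<ge> k"
      then show "coeff (q - smult (coeff q k) (S k)) i = 0"
        using Suc.prems(1)[of i] by (cases "i = k") (auto simp: coeff_S_above)
    qed (use Suc.prems in simp)
    then show ?case
      using Suc.prems(2) by (simp add: algebra_simps L_diff L_smult orthogonal)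
  qed
  have "L ((q - smult (coeff q n) (S n)) * S n) = 0"
  proof (rule lower[where k = n])
    fix i assume "i \<ge> n"
    then show "coeff (q - smult (coeff q n) (S n)) i = 0"
      using assms[of i] by (cases "i = n") (auto simp: coeff_S_above)
  qed simp
  then show ?thesis
    by (simp add: algebra_simps L_diff L_smult h_def)
qed

lemma eq_0_if_orthogonal:
  assumes "\<And>i. i \<ge> k \<Longrightarrow> coeff p i = 0" "\<And>j. j < k \<Longrightarrow> L (p * S j) = 0"
  shows "p = 0"
  using assms
proof (induction k)
  case 0
  then show ?case by (intro poly_eqI) simp
next
  case (Suc k)
  have "coeff p k * h k = L (p * S k)"
    using Suc.prems(1) by (intro L_times_S[symmetric]) auto
  then have "coeff p k = 0"
    using Suc.prems(2)[of k] h_pos[of k] by simp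
  then have "coeff p i = 0" if "i \<ge> k" for i
    using Suc.prems(1)[of i] that by (cases "i = k") auto
  then show ?case
    using Suc.prems(2) by (intro Suc.IH) auto
qed

text \<open>Reflection preserves the functional, hence orthogonality to all polynomials of degree below \<open>n\<close>;
  such a polynomial of degree \<open>n\<close> is determined by its leading coefficient.\<close>

lemma S_reflect: "S n \<circ>\<^sub>p [:0, -1:] = smult ((-1) ^ n) (S n)"
proof -
  let ?R = "\<lambda>p. p \<circ>\<^sub>p [:0, -1 :: real:]"
  have "?R (S n) - smult ((-1) ^ n) (S n) = 0"
  proof (rule eq_0_if_orthogonal[where k = n])
    fix i assume "i \<ge> n"
    then show "coeff (?R (S n) - smult ((-1) ^ n) (S n)) i = 0"
      by (cases "i = n") (auto simp: coeff_pcompose_linear coeff_S_above)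
  next
    fix j assume "j < n"
    have "L (?R (S n) * S j) = L (?R (S j) * S n)"
      using L_reflect[of "?R (S n) * S j"] by (simp add: pcompose_mult reflect_reflect mult.commute)
    also have "\<dots> = 0"
      using \<open>j < n\<close> by (subst L_times_S) (auto simp: coeff_pcompose_linear coeff_S_above)
    finally show "L ((?R (S n) - smult ((-1) ^ n) (S n)) * S j) = 0"
      using \<open>j < n\<close> by (simp add: algebra_simps L_diff L_smult orthogonal)
  qed
  then show ?thesis by simp
qed

lemma poly_S_0_odd:
  assumes "odd n"
  shows "poly (S n) 0 = 0"
proof -
  have "poly (S n \<circ>\<^sub>p [:0, -1:]) 0 = poly (smult ((-1) ^ n) (S n)) 0"
    by (simp only: S_reflect)
  with assms show ?thesis by (simp add: poly_pcompose)
qed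

lemma L_X_S_S: "L ([:0, 1:] * S n * S n) = 0"
proof -
  have "([:0, 1:] * S n * S n) \<circ>\<^sub>p [:0, -1:] = - ([:0, 1:] * S n * S n)"
    by (simp add: pcompose_mult S_reflect pcompose_pCons flip: power_mult_distrib)
  then show ?thesis
    using L_reflect[of "[:0, 1:] * S n * S n"] by (simp only: L_minus)
qed

definition b :: "nat \<Rightarrow> real" where
  "b n = (if n = 0 then 0 else h n / h (n - 1))"

lemma b_0 [simp]: "b 0 = 0"
  by (simp add: b_def)

lemma b_h: "b (Suc n) * h n = h (Suc n)"
  using h_pos[of n] by (simp add: b_def)

text \<open>The remainder has degree at most \<open>n\<close>, so it suffices to test it against \<open>S 0, \<dots>, S n\<close>. Evenness
  disposes of the test against \<open>S n\<close>, which is why \<open>x S n\<close> has no component along \<open>S n\<close>.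
  At \<open>n = 0\<close> the truncated index \<open>n - 1\<close> is harmless because \<open>b 0 = 0\<close>.\<close>

lemma three_term: "[:0, 1:] * S n = S (Suc n) + smult (b n) (S (n - 1))"
proof -
  let ?p = "[:0, 1:] * S n - S (Suc n) - smult (b n) (S (n - 1))"
  have "?p = 0"
  proof (rule eq_0_if_orthogonal[where k = "Suc n"])
    fix i assume "i \<ge> Suc n"
    then show "coeff ?p i = 0"
      by (cases "i = Suc n") (auto simp: coeff_S_above coeff_pCons split: nat.splits)
  next
    fix j assume "j < Suc n"
    then consider "j = n" | "Suc j = n" | "Suc j < n" by linarith
    then show "L (?p * S j) = 0"
    proof cases
      case 1
      have "b n * L (S (n - 1) * S n) = 0"
        by (cases n) (auto simp: orthogonal)
      with 1 L_X_S_S[of n] show ?thesis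
        by (simp add: algebra_simps L_diff L_add L_smult orthogonal)
    next
      case 2
      have "L (([:0, 1:] * S j) * S n) = h n"
        using 2 by (subst L_times_S) (auto simp: coeff_pCons coeff_S_above split: nat.splits)
      moreover have "b n * L (S (n - 1) * S j) = h n"
        using 2 b_h[of j] by (auto simp: h_def)
      ultimately show ?thesis
        using 2 by (simp add: algebra_simps L_diff L_add L_smult orthogonal)
    next
      case 3
      have "L (([:0, 1:] * S j) * S n) = 0"
        using 3 by (subst L_times_S) (auto simp: coeff_pCons coeff_S_above split: nat.splits)
      then show ?thesis
        using 3 by (simp add: algebra_simps L_diff L_add L_smult orthogonal)
    qed
  qed
  then show ?thesis by (simp add: algebra_simps)
qed

lemma recurrence_coeff_eq: "recurrence_coeff S k = b (nat k)"
proof (cases "k \<le> 0")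
  case False
  then obtain m where m: "nat k = Suc m" by (metis gr0_conv_Suc not_le zero_less_nat_eq)
  have "(THE c. S (nat k + 1) = [:0, 1:] * S (nat k) - smult c (S (nat k - 1))) = b (nat k)"
  proof (rule the_equality)
    show "S (nat k + 1) = [:0, 1:] * S (nat k) - smult (b (nat k)) (S (nat k - 1))"
      using three_term[of "nat k"] by simp
    show "c = b (nat k)" if "S (nat k + 1) = [:0, 1:] * S (nat k) - smult c (S (nat k - 1))" for c
    proof -
      have "smult c (S (nat k - 1)) = smult (b (nat k)) (S (nat k - 1))"
        using that three_term[of "nat k"] by simp
      then have "coeff (smult c (S (nat k - 1))) (nat k - 1)
          = coeff (smult (b (nat k)) (S (nat k - 1))) (nat k - 1)" by simp
      then show ?thesis by (simp only: coeff_smult coeff_S_self mult_1_right)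
    qed
  qed
  with False show ?thesis by (simp add: recurrence_coeff_def)
qed (simp add: recurrence_coeff_def)

text \<open>The products \<open>x\<^sup>2 S (m + 1)\<close> and \<open>x\<^sup>3 S m\<close> are expanded separately because the moment
  \<open>L (x\<^sup>5 S (m + 1) S m)\<close> splits into them; each expansion then has only a few terms.\<close>

lemma X2_S: "[:0, 1:] ^ 2 * S (Suc m) = S (m + 3) + smult (b (m + 2) + b (m + 1)) (S (m + 1))
    + smult (b (m + 1) * b m) (S (m - 1))"
proof -
  define X :: "real poly" where "X = [:0, 1:]"
  have X_S: "X * S n = S (Suc n) + smult (b n) (S (n - 1))" for n
    unfolding X_def by (rule three_term)
  have "X ^ 2 * S (Suc m) = X * S (Suc (Suc m)) + smult (b (Suc m)) (X * S m)"
    using X_S[of "Suc m"] by (simp add: power2_eq_square mult.assoc distrib_left)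
  also have "\<dots> = S (m + 3) + smult (b (m + 2) + b (m + 1)) (S (m + 1))
    + smult (b (m + 1) * b m) (S (m - 1))"
    unfolding X_S by (simp add: eval_nat_numeral smult_add_left smult_add_right)
  finally show ?thesis unfolding X_def .
qed

lemma X3_S: "[:0, 1:] ^ 3 * S m = S (m + 3) + smult (b (m + 2) + b (m + 1) + b m) (S (m + 1))
    + smult (b m * (b (m + 1) + b m + b (m - 1))) (S (m - 1))
    + smult (b m * b (m - 1) * b (m - 2)) (S (m - 3))"
proof -
  define X :: "real poly" where "X = [:0, 1:]"
  have X_S: "X * S n = S (Suc n) + smult (b n) (S (n - 1))" for n
    unfolding X_def by (rule three_term)
  \<comment> \<open>The truncated index \<open>k - 1\<close> does no harm in front of the factor \<open>b k\<close>, because \<open>b 0 = 0\<close>.\<close>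
  have X_S_pred: "smult (b k) (X * S (k - 1)) = smult (b k) (S k + smult (b (k - 1)) (S (k - 2)))" for k
    by (cases k) (simp_all add: X_S numeral_2_eq_2)
  have "X * S m = S (m + 1) + smult (b m) (S (m - 1))"
    by (simp add: X_S)
  then have "X ^ 2 * S m = X * S (m + 1) + smult (b m) (X * S (m - 1))"
    by (simp add: power2_eq_square mult.assoc distrib_left)
  also have "\<dots> = S (m + 2) + smult (b (m + 1) + b m) (S m) + smult (b m * b (m - 1)) (S (m - 2))"
    unfolding X_S_pred using X_S[of "m + 1"] by (simp add: smult_add_left smult_add_right)
  finally have "X ^ 3 * S m = X * S (m + 2) + smult (b (m + 1) + b m) (X * S m)
      + smult (b m) (smult (b (m - 1)) (X * S (m - 1 - 1)))"
    by (simp add: eval_nat_numeral mult.assoc distrib_left)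
  also have "\<dots> = S (m + 3) + smult (b (m + 2) + b (m + 1) + b m) (S (m + 1))
    + smult (b m * (b (m + 1) + b m + b (m - 1))) (S (m - 1))
    + smult (b m * b (m - 1) * b (m - 2)) (S (m - 3))"
    unfolding X_S_pred unfolding X_S
    by (simp add: eval_nat_numeral smult_add_left smult_add_right algebra_simps)
  finally show ?thesis unfolding X_def .
qed

lemma L_X5_S_S:
  "L ([:0, 1:] ^ 5 * S (Suc m) * S m) = h m * b (m + 1) *
     (b (m + 3) * b (m + 2) + (b (m + 1) + b (m + 2)) * (b m + b (m + 1) + b (m + 2))
       + b m * (b (m + 1) + b m + b (m - 1)))"
proof -
  have split: "[:0, 1:] ^ 5 * S (Suc m) * S m = ([:0, 1:] ^ 2 * S (Suc m)) * ([:0, 1:] ^ 3 * S m)"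
    by (simp add: mult_ac flip: power_add)
  have expand: "L (([:0, 1:] ^ 2 * S (Suc m)) * ([:0, 1:] ^ 3 * S m)) = h (m + 3) + (b (m + 2) + b (m + 1)) * (b (m + 2) + b (m + 1) + b m) * h (m + 1)
     + b (m + 1) * b m * (b m * (b (m + 1) + b m + b (m - 1))) * h (m - 1)"
  proof -
    (* The term with S (m - 3) is orthogonal to the rest if m \<ge> 3, and otherwise its
       coefficient r contains the factor b 0 = 0. *)
    define r where "r = b m * b (m - 1) * b (m - 2)"
    have "L (S k * S (m - 3)) = 0" if "r \<noteq> 0" "k \<in> {m - 1, m + 1, m + 3}" for k
    proof -
      consider "m = 0" | "m = 1" | "m = 2" | "m \<ge> 3" by linarith
      then show ?thesis using that by cases (auto simp: r_def orthogonal)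
    qed
    then have zero: "r = 0 \<or> L (S (m + 3) * S (m - 3)) = 0 \<and> L (S (m + 1) * S (m - 3)) = 0 \<and>
      L (S (m - 1) * S (m - 3)) = 0" by auto
    have orth: "L (S (m + 3) * S (m + 1)) = 0" "L (S (m + 3) * S (m - 1)) = 0"
      "L (S (m + 1) * S (m + 3)) = 0" "L (S (m + 1) * S (m - 1)) = 0"
      "L (S (m - 1) * S (m + 3)) = 0" "L (S (m - 1) * S (m + 1)) = 0"
      by (auto intro!: orthogonal)
    show ?thesis
      unfolding X2_S X3_S r_def[symmetric] distrib_left distrib_right L_add
        mult_smult_left mult_smult_right L_smult orth h_def
      using zero by (elim disjE conjE) (simp_all add: mult.assoc)
  qed
  have h1: "h (m + 1) = b (m + 1) * h m"
    using b_h[of m] by simp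
  have h2: "h (m + 2) = b (m + 2) * h (m + 1)"
    using b_h[of "m + 1"] by simp
  have h3: "h (m + 3) = b (m + 3) * h (m + 2)"
    using b_h[of "m + 2"] by (simp add: eval_nat_numeral)
  have "b m * (b m * h (m - 1)) = b m * h m"
    using b_h[of "m - 1"] by (cases m) auto
  moreover have "b (m + 1) * b m * (b m * c) * h (m - 1) = b (m + 1) * c * (b m * (b m * h (m - 1)))" for c
    by (simp only: mult_ac)
  ultimately have h0: "b (m + 1) * b m * (b m * c) * h (m - 1) = b (m + 1) * c * (b m * h m)" for c
    by (simp only:)
  have ring: "b3 * (b2 * (b1 * H)) + (b2 + b1) * (b2 + b1 + b0) * (b1 * H) + b1 * (b1 + b0 + b') * (b0 * H)
      = H * b1 * (b3 * b2 + (b1 + b2) * (b0 + b1 + b2) + b0 * (b1 + b0 + b'))" for H b' b0 b1 b2 b3 :: real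
    by algebra
  show ?thesis
    unfolding split expand h0 unfolding h3 h2 h1 by (rule ring)
qed

end

section \<open>String equation and ladder relations\<close>

locale sextic_freud_polys = even_orthogonal_polys +
  fixes lam t :: real
  assumes by_parts: "L ([:0, 1:] * pderiv p + [:2 * lam + 2, 0, 2 * t, 0, 0, 0, -6:] * p) = 0"
begin

text \<open>Exactly one of two consecutive orthogonal polynomials is odd, and the quotient by \<open>x\<close> is taken
  from that one. If it is \<open>S (m + 1)\<close>, the quotient is monic of degree \<open>m\<close>; if it is \<open>S m\<close>, the
  quotient has degree \<open>m - 1\<close> and is orthogonal to \<open>S (m + 1)\<close>. This is the origin of all
  terms with \<open>1 - (- 1) ^ n\<close>.\<close>

lemma S_S_div_X:
  obtains p where "[:0, 1:] * p = S (Suc m) * S m" "L p = (if even m then h m else 0)"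
proof (cases "even m")
  case True
  then have "poly (S (Suc m)) 0 = 0" by (intro poly_S_0_odd) simp
  then obtain u where u: "S (Suc m) = [:0, 1:] * u"
    by (auto simp: poly_eq_0_iff_dvd)
  have coeff_u: "coeff u i = coeff (S (Suc m)) (Suc i)" for i
    by (simp add: u)
  have "L (u * S m) = h m"
    by (subst L_times_S) (simp_all add: coeff_u coeff_S_above)
  with True u that[of "u * S m"] show ?thesis by simp
next
  case False
  then have "poly (S m) 0 = 0" by (intro poly_S_0_odd) simp
  then obtain u where u: "S m = [:0, 1:] * u"
    by (auto simp: poly_eq_0_iff_dvd)
  have coeff_u: "coeff u i = coeff (S m) (Suc i)" for i
    by (simp add: u)
  have "L (u * S (Suc m)) = 0"
    by (subst L_times_S) (simp_all add: coeff_u coeff_S_above)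
  with False u that[of "u * S (Suc m)"] show ?thesis by (simp add: mult.commute)
qed

text \<open>The moment \<open>L ((S (m + 1) S m)')\<close> is evaluated in two ways: by orthogonality it equals
  \<open>(m + 1) h m\<close>, and integration by parts turns it into moments of \<open>x\<^sup>5 S (m + 1) S m\<close>, \<open>x S (m + 1) S m\<close>
  and \<open>S (m + 1) S m / x\<close>.\<close>

lemma string_equation_Suc:
  "6 * b (m + 1) *
     (b (m + 3) * b (m + 2) + (b (m + 1) + b (m + 2)) * (b m + b (m + 1) + b (m + 2))
       + b m * (b (m + 1) + b m + b (m - 1))) - 2 * t * b (m + 1)
   = real (Suc m) + (if even m then 2 * lam + 1 else 0)"
  (is "6 * ?b * ?V - _ = _")
proof -
  obtain p where p: "[:0, 1:] * p = S (Suc m) * S m" "L p = (if even m then h m else 0)"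
    by (rule S_S_div_X)
  have weight: "[:2 * lam + 2, 0, 2 * t, 0, 0, 0, -6:] * p
      = smult (2 * lam + 2) p + smult (2 * t) ([:0, 1:] * ([:0, 1:] * p))
        - smult 6 ([:0, 1:] ^ 5 * ([:0, 1:] * p))"
    by (simp add: eval_nat_numeral)
  have "L ([:0, 1:] * ([:0, 1:] * p)) = L (([:0, 1:] * S m) * S (Suc m))"
    unfolding p(1) by (simp only: mult_ac)
  also have "\<dots> = h (Suc m)"
    by (subst L_times_S) (auto simp: coeff_pCons coeff_S_above split: nat.splits)
  finally have X2: "L ([:0, 1:] * ([:0, 1:] * p)) = ?b * h m"
    by (simp add: b_h)
  have X6: "L ([:0, 1:] ^ 5 * ([:0, 1:] * p)) = h m * ?b * ?V"
    unfolding p(1) L_X5_S_S[symmetric] by (simp only: mult.assoc)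
  have "L ([:0, 1:] * pderiv p) + ((2 * lam + 2) * L p + 2 * t * (?b * h m) - 6 * (h m * ?b * ?V)) = 0"
    using by_parts[of p] unfolding weight L_add L_diff L_smult X2 X6 .
  moreover have "real (Suc m) * h m = L p + L ([:0, 1:] * pderiv p)"
  proof -
    have "L (pderiv (S (Suc m)) * S m) = real (Suc m) * h m"
      by (subst L_times_S) (simp_all add: coeff_pderiv coeff_S_above)
    moreover have "L (pderiv (S m) * S (Suc m)) = 0"
      by (subst L_times_S) (simp_all add: coeff_pderiv coeff_S_above)
    moreover have "pderiv ([:0, 1:] * p) = p + [:0, 1:] * pderiv p"
      by (simp add: pderiv_pCons)
    moreover have "pderiv ([:0, 1:] * p) = pderiv (S (Suc m)) * S m + pderiv (S m) * S (Suc m)"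
      unfolding p(1) pderiv_mult by (simp only: mult_ac add_ac)
    ultimately show ?thesis by (metis L_add add.right_neutral)
  qed
  ultimately have "h m * (6 * ?b * ?V - 2 * t * ?b) = h m * real (Suc m) + (2 * lam + 1) * L p"
    by (simp add: algebra_simps)
  also have "\<dots> = h m * (real (Suc m) + (if even m then 2 * lam + 1 else 0))"
    unfolding p(2) by (simp add: algebra_simps)
  finally show ?thesis
    using h_pos[of m] by (simp only: mult_cancel_left) simp
qed

abbreviation \<beta> :: "int \<Rightarrow> real" where
  "\<beta> \<equiv> recurrence_coeff S"

text \<open>In terms of the integer-indexed coefficients no truncated subtraction is left, since \<open>\<beta>\<close> vanishes
  at all indices \<open>k \<le> 0\<close>.\<close>

lemma string_equation:
  "6 * \<beta> (int n) * (\<beta> (int n + 2) * \<beta> (int n + 1)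
       + (\<beta> (int n) + \<beta> (int n + 1)) * (\<beta> (int n - 1) + \<beta> (int n) + \<beta> (int n + 1))
       + \<beta> (int n - 1) * (\<beta> (int n) + \<beta> (int n - 1) + \<beta> (int n - 2))) - 2 * t * \<beta> (int n)
   = real n + (lam + 1 / 2) * (1 - (- 1) ^ n)"
proof (cases n)
  case 0
  then show ?thesis by (simp add: recurrence_coeff_eq)
next
  case (Suc m)
  have index: "nat (int (Suc m)) = m + 1" "nat (int (Suc m) + 2) = m + 3" "nat (int (Suc m) + 1) = m + 2"
    "nat (int (Suc m) - 1) = m" "nat (int (Suc m) - 2) = m - 1" by linarith+
  have "real (Suc m) + (if even m then 2 * lam + 1 else 0)
      = real (Suc m) + (lam + 1 / 2) * (1 - (- 1) ^ Suc m)" by simp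
  with string_equation_Suc[of m] show ?thesis
    unfolding Suc recurrence_coeff_eq index by (simp only:)
qed

text \<open>Polynomial versions of \<open>C\<^sub>n\<close> and \<open>D\<^sub>n\<close>. In the usual notation of ladder operators, with
  \<open>v = - ln w\<close>, one has \<open>A\<^sub>n = 6 C\<^sub>n\<close>; the polynomials \<open>E n\<close> and \<open>V\<close> below are \<open>x B\<^sub>n(x)\<close> and
  \<open>x v'(x)\<close>.\<close>

definition C :: "int \<Rightarrow> real poly" where
  "C n = [:0, 1:] ^ 4 - [:t / 3:] + [:0, 1:] ^ 2 * [:\<beta> n + \<beta> (n + 1):]
     + [:\<beta> (n + 2) * \<beta> (n + 1) + (\<beta> (n + 1) + \<beta> n) ^ 2 + \<beta> (n - 1) * \<beta> n:]"

definition D :: "int \<Rightarrow> real poly" where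
  "D n = [:0, 1:] ^ 2 + [:\<beta> (n - 1) + \<beta> n + \<beta> (n + 1):]"

definition E :: "nat \<Rightarrow> real poly" where
  "E n = 6 * [:0, 1:] ^ 2 * [:\<beta> (int n):] * D (int n) + [:lam + 1 / 2:] * (1 - (- 1) ^ n)"

definition V :: "real poly" where
  "V = 6 * [:0, 1:] ^ 6 - [:2 * t:] * [:0, 1:] ^ 2 - [:2 * lam + 1:]"

text \<open>The first compatibility condition of the ladder operators. Here it is a formal identity in the
  recurrence coefficients.\<close>

lemma E_add_E_Suc: "E n + E (Suc n) + V = 6 * [:0, 1:] ^ 2 * C (int n)"
proof -
  have "poly (E n + E (Suc n) + V) x = poly (6 * [:0, 1:] ^ 2 * C (int n)) x" for x
    unfolding E_def D_def C_def V_def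
    by (simp add: add.commute[of 1] power2_eq_square, simp add: field_simps eval_nat_numeral)
  then show ?thesis by (simp flip: poly_eq_poly_eq_iff add: fun_eq_iff)
qed

text \<open>The second compatibility condition. The coefficients of the positive powers of \<open>x\<close> agree formally;
  the constant coefficient is the difference of two consecutive string equations.\<close>

lemma E_Suc_minus_E:
  "1 + E (Suc n) - E n = 6 * ([:\<beta> (int n + 1):] * C (int n + 1) - [:\<beta> (int n):] * C (int n - 1))"
proof -
  define s :: real where "s = (- 1) ^ n"
  note str = string_equation[of n] string_equation[of "Suc n"]
  have index: "int (Suc n) = int n + 1" "int n + 1 + 2 = int n + 3" "int n + 1 + 1 = int n + 2"
     "int n + 1 - 1 = int n" "int n + 1 - 2 = int n - 1" "int n - 1 + 2 = int n + 1"
     "int n - 1 + 1 = int n" "int n - 1 - 1 = int n - 2" by auto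
  have "poly (1 + E (Suc n) - E n) x
      = poly (6 * ([:\<beta> (int n + 1):] * C (int n + 1) - [:\<beta> (int n):] * C (int n - 1))) x" for x
    using str unfolding E_def D_def C_def index power_Suc s_def[symmetric]
    by (simp flip: s_def) algebra
  then show ?thesis by (simp flip: poly_eq_poly_eq_iff add: fun_eq_iff)
qed

lemma three_term_const: "[:0, 1:] * S n = S (Suc n) + [:\<beta> (int n):] * S (n - 1)"
  using three_term[of n] by (simp add: recurrence_coeff_eq)

text \<open>Eliminating \<open>S (n - 1)\<close> by the recurrence and \<open>E n\<close> by the first compatibility condition
  turns the lowering relation at \<open>n\<close> into the raising relation from \<open>n\<close> to \<open>n + 1\<close>.\<close>

lemma raising_from_lowering:
  assumes "[:0, 1:] * pderiv (S n) = 6 * [:0, 1:] * [:\<beta> (int n):] * C (int n) * S (n - 1) - E n * S n"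
  shows "[:0, 1:] * pderiv (S n) = (E (Suc n) + V) * S n - 6 * [:0, 1:] * C (int n) * S (Suc n)"
proof -
  have ring: "6 * X * B * c * r - e * q = (e' + v) * q - 6 * X * c * p"
    if "X * q = p + B * r" "e + e' + v = 6 * X ^ 2 * c" for X q p B r e e' v c :: "real poly"
    using that by algebra
  show ?thesis
    unfolding assms by (rule ring[OF three_term_const E_add_E_Suc])
qed

text \<open>Differentiating the recurrence expresses \<open>S'(n + 1)\<close> through \<open>S'(n)\<close> and \<open>S'(n - 1)\<close>. Lowering at \<open>n\<close>
  and raising from \<open>n - 1\<close> remove these derivatives; comparing coefficients of \<open>S n\<close> and \<open>S (n - 1)\<close>
  leaves precisely the two compatibility conditions.\<close>

lemma lowering:
  "[:0, 1:] * pderiv (S n) = 6 * [:0, 1:] * [:\<beta> (int n):] * C (int n) * S (n - 1) - E n * S n"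
proof (induction n rule: less_induct)
  case (less n)
  show ?case
  proof (cases n)
    case 0
    then show ?thesis by (simp add: S_0 E_def recurrence_coeff_eq)
  next
    case (Suc m)
    have IH: "[:0, 1:] * pderiv (S m) = 6 * [:0, 1:] * [:\<beta> (int m):] * C (int m) * S (m - 1) - E m * S m"
      using Suc by (intro less.IH) simp
    have pred: "[:\<beta> (int m):] * ([:0, 1:] * pderiv (S (m - 1)))
        = [:\<beta> (int m):] * ((E m + V) * S (m - 1) - 6 * [:0, 1:] * C (int m - 1) * S m)"
    proof (cases m)
      case 0
      then show ?thesis by (simp add: recurrence_coeff_eq)
    next
      case (Suc k)
      with \<open>n = Suc m\<close> have "[:0, 1:] * pderiv (S k)
          = (E (Suc k) + V) * S k - 6 * [:0, 1:] * C (int k) * S (Suc k)"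
        by (intro raising_from_lowering less.IH) simp
      with Suc show ?thesis by simp
    qed
    have deriv: "S m + [:0, 1:] * pderiv (S m) = pderiv (S (Suc m)) + [:\<beta> (int m):] * pderiv (S (m - 1))"
      using arg_cong[OF three_term_const[of m], of pderiv]
      by (simp add: pderiv_mult pderiv_add pderiv_pCons pderiv_smult)
    have ring: "X * P' = 6 * X * B' * c' * p - e' * P"
      if "X * p = P + B * q" "p + X * p' = P' + B * q'" "X * p' = 6 * X * B * c * q - e * p"
        "B * (X * q') = B * ((e + v) * q - 6 * X * c0 * p)"
        "e + e' + v = 6 * X ^ 2 * c" "1 + e' - e = 6 * (B' * c' - B * c0)"
      for X p P B q p' P' q' c c0 c' e e' v B' :: "real poly"
    proof -
      have "X * P' = X * p + X * (X * p') - B * (X * q')"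
        using that(2) by algebra
      also have "\<dots> = X * p * (1 + e' - e + 6 * B * c0) - X * p * e' + B * q * (6 * X ^ 2 * c - e - v)"
        unfolding that(3,4) by algebra
      also have "\<dots> = X * p * (6 * B' * c') - (X * p - B * q) * e'"
        using that(5,6) by algebra
      also have "X * p - B * q = P"
        using that(1) by simp
      finally show ?thesis by (simp only: mult_ac)
    qed
    show ?thesis
      using ring[OF three_term_const deriv IH pred E_add_E_Suc E_Suc_minus_E]
      by (simp add: Suc add.commute)
  qed
qed

text \<open>The factor \<open>\<beta> n\<close> makes the relation valid at \<open>n = 0\<close>, where there is no predecessor.\<close>

lemma raising:
  "[:\<beta> (int n):] * ([:0, 1:] * pderiv (S (n - 1)))
     = [:\<beta> (int n):] * ((E n + V) * S (n - 1) - 6 * [:0, 1:] * C (int n - 1) * S n)"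
proof (cases n)
  case 0
  then show ?thesis by (simp add: recurrence_coeff_eq)
next
  case (Suc k)
  with raising_from_lowering[OF lowering, of k] show ?thesis by simp
qed

lemma X_pderiv_C:
  "[:0, 1:] * pderiv (C n) = 4 * [:0, 1:] ^ 4 + 2 * [:0, 1:] ^ 2 * [:\<beta> n + \<beta> (n + 1):]"
  unfolding C_def
  by (simp add: pderiv_add pderiv_diff pderiv_mult pderiv_power pderiv_pCons eval_nat_numeral numeral_poly)

lemma pderiv_E:
  "pderiv (E n) = 12 * [:0, 1:] * [:\<beta> (int n):] * D (int n) + 12 * [:0, 1:] ^ 3 * [:\<beta> (int n):]"
proof -
  have const: "pderiv ([:lam + 1 / 2:] * (1 - (- 1) ^ n)) = 0"
    by (cases "even n") (simp_all add: pderiv_pCons pderiv_smult numeral_poly)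
  show ?thesis
    unfolding E_def D_def pderiv_add const
    by (simp add: pderiv_mult pderiv_power pderiv_pCons eval_nat_numeral numeral_poly)
qed

text \<open>Differentiate the lowering relation, replace the derivative of \<open>S (n - 1)\<close> by the raising relation,
  and eliminate the remaining \<open>S (n - 1)\<close> by the lowering relation again. That last step divides by
  \<open>6 x \<beta>\<^sub>n C\<^sub>n\<close>; multiplication by \<open>x C\<^sub>n\<close> keeps the equation polynomial and valid for \<open>\<beta>\<^sub>n = 0\<close>.\<close>

lemma second_order_equation:
  fixes n :: nat
  defines "X \<equiv> [:0, 1:]" and "c \<equiv> C (int n)" and "s \<equiv> [:\<beta> (int n) + \<beta> (int n + 1):]"
  shows "X ^ 2 * c * pderiv (pderiv (S n)) =
     - X * c * pderiv (S n)
     + (c + 4 * X ^ 4 + 2 * X ^ 2 * s) * (X * pderiv (S n) + E n * S n)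
     - 36 * X ^ 2 * [:\<beta> (int n):] * c ^ 2 * C (int n - 1) * S n
     + c * (E n + V) * (X * pderiv (S n) + E n * S n)
     - X * c * pderiv (E n) * S n - X * c * E n * pderiv (S n)"
proof -
  have ring: "X ^ 2 * c * p'' = - X * c * p' + (c + xc) * (X * p' + e * p)
      - 36 * X ^ 2 * B * c ^ 2 * c0 * p + c * (e + v) * (X * p' + e * p) - X * c * e' * p - X * c * e * p'"
    if "X * p' = 6 * X * B * c * q - e * p" "B * (X * q') = B * ((e + v) * q - 6 * X * c0 * p)"
      "p' + X * p'' = 6 * B * (c * q + X * c' * q + X * c * q') - (e' * p + e * p')" "X * c' = xc"
    for X B c c0 c' p p' p'' q q' e e' v xc :: "real poly"
  proof -
    have q: "6 * X * B * c * q = X * p' + e * p"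
      using that(1) by algebra
    have "X ^ 2 * c * p'' = X * c * (p' + X * p'') - X * c * p'"
      by algebra
    also have "\<dots> = (c + X * c') * (6 * X * B * c * q) + 6 * X * c ^ 2 * (B * (X * q'))
        - X * c * (e' * p + e * p') - X * c * p'"
      unfolding that(3) by algebra
    also have "\<dots> = (c + xc) * (6 * X * B * c * q) + c * (e + v) * (6 * X * B * c * q)
        - 36 * X ^ 2 * B * c ^ 2 * c0 * p - X * c * (e' * p + e * p') - X * c * p'"
      unfolding that(2,4) by algebra
    finally show ?thesis unfolding q by algebra
  qed
  have deriv: "pderiv (S n) + X * pderiv (pderiv (S n)) =
      6 * [:\<beta> (int n):] * (c * S (n - 1) + X * pderiv c * S (n - 1) + X * c * pderiv (S (n - 1)))
      - (pderiv (E n) * S n + E n * pderiv (S n))"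
  proof -
    have X': "pderiv X = 1" unfolding X_def by (simp add: pderiv_pCons)
    have B': "pderiv [:\<beta> (int n):] = 0" by (simp add: pderiv_pCons)
    have "pderiv (X * pderiv (S n)) = pderiv (6 * X * [:\<beta> (int n):] * c * S (n - 1) - E n * S n)"
      using lowering[of n] unfolding X_def c_def by simp
    then show ?thesis
      unfolding pderiv_mult pderiv_diff X' B' pderiv_numeral by algebra
  qed
  show ?thesis
    using ring[OF lowering[of n] raising[of n] deriv[unfolded X_def c_def] X_pderiv_C[of "int n"]]
    unfolding X_def c_def s_def by (simp only: add.assoc)
qed

end

section \<open>The differential equation\<close>

lemma to_fract_power: "to_fract (p ^ n) = to_fract p ^ n"
  by (induction n) simp_all

lemma to_fract_numeral: "to_fract (numeral k) = numeral k"
proof -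
  have "to_fract (of_nat n) = of_nat n" for n by (induction n) simp_all
  from this[of "numeral k"] show ?thesis by simp
qed

lemma sextic_freud_polys_freud_moment:
  assumes "lam > -1" "monic_orthogonal_polys (sextic_freud_weight lam t) S"
  shows "sextic_freud_polys (freud_moment lam t) S lam t"
proof unfold_locales
  show "freud_moment lam t (p + q) = freud_moment lam t p + freud_moment lam t q" for p q
    unfolding freud_moment_def poly_add distrib_right
    by (intro Bochner_Integration.integral_add integrable_poly_weight assms(1))
  show "freud_moment lam t (smult c p) = c * freud_moment lam t p" for c p
    by (simp add: freud_moment_def mult.assoc)
  show "freud_moment lam t (S m * S n) = 0" if "m \<noteq> n" for m n
    using assms(2) that by (simp add: monic_orthogonal_polys_def freud_moment_def)
  show "degree (S n) = n" "lead_coeff (S n) = 1" for n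
    using assms(2) unfolding monic_orthogonal_polys_def by blast+
qed (intro freud_moment_square_pos freud_moment_reflect freud_moment_by_parts assms(1); assumption)+

theorem theorem4p3:
  fixes lam t :: real and S :: "nat \<Rightarrow> real poly" and n :: nat
  assumes "lam > -1"
    and "monic_orthogonal_polys (sextic_freud_weight lam t) S"
  shows "ratX * to_fract (pderiv (pderiv (S n)))
           + freud_Q lam t (recurrence_coeff S) (int n) * to_fract (pderiv (S n))
           + freud_T lam t (recurrence_coeff S) n * to_fract (S n) = 0"
proof -
  interpret sextic_freud_polys "freud_moment lam t" S lam t
    by (rule sextic_freud_polys_freud_moment) fact+
  (* Names for all atoms, so that the remaining work is an identity in a field. *)
  define x c c0 d where "x = ratX" and "c = to_fract (C (int n))" and "c0 = to_fract (C (int n - 1))"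
    and "d = to_fract (D (int n))"
  define s where "s = ratconst (\<beta> (int n) + \<beta> (int n + 1))"
  define B where "B = ratconst (\<beta> (int n))"
  define a where "a = ratconst (lam + 1 / 2)"
  define \<tau> where "\<tau> = ratconst (2 * t)"
  define sg :: ratfun where "sg = (- 1) ^ n"
  define p p' p'' where "p = to_fract (S n)" and "p' = to_fract (pderiv (S n))"
    and "p'' = to_fract (pderiv (pderiv (S n)))"
  define e where "e = 6 * x ^ 2 * B * d + a * (1 - sg)"
  have X: "to_fract [:0, 1:] = x" by (simp add: x_def ratX_def)
  have a2: "ratconst (2 * lam + 1) = 2 * a"
  proof -
    have "[:2 * lam + 1:] = 2 * [:lam + 1 / 2:]" by (simp add: numeral_poly)
    then have "to_fract [:2 * lam + 1:] = to_fract (2 * [:lam + 1 / 2:])" by (simp only:)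
    then show ?thesis unfolding a_def ratconst_def to_fract_mult to_fract_numeral .
  qed
  have C: "freud_C t \<beta> k = to_fract (C k)" for k
    unfolding freud_C_def C_def ratX_def ratconst_def
    by (simp only: to_fract_add to_fract_diff to_fract_mult to_fract_power)
  have D: "freud_D \<beta> (int n) = d"
    unfolding freud_D_def d_def D_def ratX_def ratconst_def
    by (simp only: to_fract_add to_fract_power)
  have E: "to_fract (E n) = e"
    unfolding E_def e_def X[symmetric] B_def d_def a_def sg_def ratconst_def
    by (simp only: to_fract_add to_fract_diff to_fract_mult to_fract_power to_fract_numeral
          to_fract_uminus to_fract_1)
  have V: "to_fract V = 6 * x ^ 6 - \<tau> * x ^ 2 - 2 * a"
    unfolding V_def X[symmetric] \<tau>_def a2[symmetric] ratconst_def
    by (simp only: to_fract_add to_fract_diff to_fract_mult to_fract_power to_fract_numeral)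
  have ode: "x ^ 2 * c * p'' = - x * c * p' + (c + 4 * x ^ 4 + 2 * x ^ 2 * s) * (x * p' + e * p)
     - 36 * x ^ 2 * B * c ^ 2 * c0 * p + c * (e + (6 * x ^ 6 - \<tau> * x ^ 2 - 2 * a)) * (x * p' + e * p)
     - x * c * (12 * x * B * d + 12 * x ^ 3 * B) * p - x * c * e * p'"
    using arg_cong[OF second_order_equation[of n, unfolded pderiv_E], of to_fract]
    unfolding to_fract_add to_fract_diff to_fract_mult to_fract_power to_fract_numeral to_fract_uminus
      E V X c_def[symmetric] c0_def[symmetric] d_def[symmetric] ratconst_def[symmetric]
      p_def[symmetric] p'_def[symmetric] p''_def[symmetric] s_def[symmetric] B_def[symmetric] .
  have x0: "x \<noteq> 0" by (simp add: x_def ratX_def)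
  have "coeff (C (int n)) 4 = 1"
    by (simp add: C_def eval_nat_numeral)
  then have c_nz: "c \<noteq> 0" unfolding c_def by auto
  have Q: "freud_Q lam t \<beta> (int n) * c = (\<tau> * x ^ 2 - 6 * x ^ 6 + 2 * a) * c - 2 * x ^ 2 * (2 * x ^ 2 + s)"
    unfolding freud_Q_def C x_def[symmetric] c_def[symmetric] \<tau>_def[symmetric] s_def[symmetric] a2
    using c_nz by (simp add: field_simps)
  have T: "freud_T lam t \<beta> n * (x * c) = 36 * x ^ 2 * B * c0 * c ^ 2 + 12 * x ^ 4 * B * c + 2 * a * e * c
      + 12 * x ^ 2 * B * d * c - e * (6 * x ^ 2 * B * d + a * (1 - sg) - \<tau> * x ^ 2 + 6 * x ^ 6) * c
      - (c + 4 * x ^ 4 + 2 * x ^ 2 * s) * e"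
    unfolding freud_T_def Let_def C D x_def[symmetric] c_def[symmetric] c0_def[symmetric]
      \<tau>_def[symmetric] s_def[symmetric] a_def[symmetric] B_def[symmetric] sg_def[symmetric] a2
      e_def[symmetric]
    using c_nz x0 by (simp add: divide_simps, insert e_def, algebra)
  (* Clearing the denominators x and C of Q and T by the nonzero factor x * C. *)
  have "(x * p'' + freud_Q lam t \<beta> (int n) * p' + freud_T lam t \<beta> n * p) * (x * c)
      = x ^ 2 * c * p'' + x * (freud_Q lam t \<beta> (int n) * c) * p' + (freud_T lam t \<beta> n * (x * c)) * p"
    by (simp add: algebra_simps power2_eq_square)
  also have "\<dots> = 0"
    unfolding ode Q T unfolding e_def by algebra
  finally show ?thesis
    using x0 c_nz by (simp add: x_def p_def p'_def p''_def)
qed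

end
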